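(* For every $n\in\mathbb{N}\setminus\{1\}$ and every $b\in(0,\infty)$, the set $\mathcal{A}_b^{(n)}$ is dense in $\mathcal{Y}_b^{(n)}$ with respect to the distance $\mathrm{d}$.
   Context: $\mathbb{N}=\{1,2,\dots\}$. $\mathcal{Y}_{\mathrm{conc}}$ (the concave Young-functions) is the set of all functions $\Phi:[0,\infty)\to[0,\infty)$ of the form $\Phi(x)=\int_0^x\varphi(t)\,dt$, where $\varphi:(0,\infty)\to(0,\infty)$ is right-continuous, decreasing and integrable on every finite interval $(0,x)$, and $\Phi(\infty):=\lim_{x\to\infty}\Phi(x)=\infty$. Here "decreasing" is meant strictly, so every function in $\mathcal{Y}_{\mathrm{conc}}$ is strictly concave. $\mathcal{A}$ is the set of $\Phi\in\mathcal{Y}_{\mathrm{conc}}$ with $\int_1^\infty\frac{\varphi(t)}{t}\,dt<\infty$. For $b\in(0,\infty)$, $\mathcal{A}_b:=\{\Phi\in\mathcal{A}:\Phi(b)=b\}$ and $\mathcal{Y}_b:=\{\Phi\in\mathcal{Y}_{\mathrm{conc}}:\Phi(b)=b\}$. For $n\ge 2$ let $\mathcal{Y}_b^{CO(n)}=\{\Delta_1\circ\cdots\circ\Delta_n:\Delta_1,\dots,\Delta_n\in\mathcal{Y}_b\}$ and $\mathcal{A}_b^{CO(n)}=\{\Phi_1\circ\cdots\circ\Phi_n:\Phi_1,\dots,\Phi_n\in\mathcal{Y}_b\text{ and }\Phi_j\in\mathcal{A}_b\text{ for some index }j\}$. For $n\ge2$, $\mathcal{Y}_b^{(n)}$ (resp.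 $\mathcal{A}_b^{(n)}$) is the set of all finite convex combinations $\sum_{i=1}^k t_i\Delta_i$ with $k$ a positive integer, $t_1,\dots,t_k\in[0,1]$, $t_1+\dots+t_k=1$, and $\Delta_1,\dots,\Delta_k\in\mathcal{Y}_b^{CO(n)}$ (resp. $\in\mathcal{A}_b^{CO(n)}$). The distance on $\mathcal{Y}_{\mathrm{conc}}$ is $\mathrm{d}(f,g)=\sqrt{\int_0^\infty\frac{(f(x)-g(x))^2}{(x+1)^4}\,dx}$ (it is finite on $\mathcal{Y}_{\mathrm{conc}}$). *)

theory Defs
  imports "HOL-Analysis.Analysis"
begin

text \<open>
  Functions on \<open>[0,\<infinity>)\<close> are represented as functions of type \<open>real \<Rightarrow> real\<close>
  that vanish on the negative half-line, so that equality of representatives is equality of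
  functions. For \<open>x < 0\<close> the interval \<open>{0<..<x}\<close> is empty and the integral
  below is 0. The convention is preserved by composition and convex combination, since all functions
  considered also vanish at 0.
\<close>

definition primitive :: "(real \<Rightarrow> real) \<Rightarrow> real \<Rightarrow> real" where
  "primitive \<phi> = (\<lambda>x. LINT t:{0<..<x}|lborel. \<phi> t)"

text \<open>
  Only the values of \<open>\<phi>\<close> on \<open>(0,\<infinity>)\<close> matter. By right-continuity they are determined by
  \<open>\<Phi>\<close>, so the existential quantifier over \<open>\<phi>\<close> in \<open>class_A\<close> below refers
  to the same density as the one in \<open>Y_conc\<close>.
\<close>

definition concave_young_density :: "(real \<Rightarrow> real) \<Rightarrow> (real \<Rightarrow> real) \<Rightarrow> bool" where
  "concave_young_density \<phi> \<Phi> \<longleftrightarrow>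
     (\<forall>t>0. \<phi> t > 0) \<and>
     (\<forall>t>0. continuous (at_right t) \<phi>) \<and>
     strict_antimono_on {0<..} \<phi> \<and>
     (\<forall>x>0. set_integrable lborel {0<..<x} \<phi>) \<and>
     \<Phi> = primitive \<phi> \<and>
     filterlim \<Phi> at_top at_top"

definition Y_conc :: "(real \<Rightarrow> real) set" where
  "Y_conc = {\<Phi>. \<exists>\<phi>. concave_young_density \<phi> \<Phi>}"

definition class_A :: "(real \<Rightarrow> real) set" where
  "class_A = {\<Phi>. \<exists>\<phi>. concave_young_density \<phi> \<Phi> \<and>
                    (\<integral>\<^sup>+t\<in>{1..}. ennreal (\<phi> t / t) \<partial>lborel) < \<infinity>}"

definition Y_at :: "real \<Rightarrow> (real \<Rightarrow> real) set" where
  "Y_at b = {\<Phi> \<in> Y_conc. \<Phi> b = b}"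

definition A_at :: "real \<Rightarrow> (real \<Rightarrow> real) set" where
  "A_at b = {\<Phi> \<in> class_A. \<Phi> b = b}"

definition compose_list :: "('a \<Rightarrow> 'a) list \<Rightarrow> 'a \<Rightarrow> 'a" where
  "compose_list fs = foldr (\<circ>) fs id"

definition Y_CO :: "nat \<Rightarrow> real \<Rightarrow> (real \<Rightarrow> real) set" where
  "Y_CO n b = {compose_list \<Delta>s | \<Delta>s. length \<Delta>s = n \<and> set \<Delta>s \<subseteq> Y_at b}"

definition A_CO :: "nat \<Rightarrow> real \<Rightarrow> (real \<Rightarrow> real) set" where
  "A_CO n b = {compose_list \<Phi>s | \<Phi>s. length \<Phi>s = n \<and> set \<Phi>s \<subseteq> Y_at b \<and>
                                     (\<exists>j<n. \<Phi>s ! j \<in> A_at b)}"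

text \<open>The library's \<open>convex hull\<close> needs a real vector space type, which function types are not.\<close>

definition convex_combinations :: "('a \<Rightarrow> real) set \<Rightarrow> ('a \<Rightarrow> real) set" where
  "convex_combinations S =
     {(\<lambda>x. \<Sum>i=1..k. t i * \<Delta> i x) | (k::nat) t \<Delta>.
        k \<ge> 1 \<and> (\<forall>i\<in>{1..k}. t i \<in> {0..1}) \<and> (\<Sum>i=1..k. t i) = 1 \<and>
        (\<forall>i\<in>{1..k}. \<Delta> i \<in> S)}"

definition Y_n :: "nat \<Rightarrow> real \<Rightarrow> (real \<Rightarrow> real) set" where
  "Y_n n b = convex_combinations (Y_CO n b)"

definition A_n :: "nat \<Rightarrow> real \<Rightarrow> (real \<Rightarrow> real) set" where
  "A_n n b = convex_combinations (A_CO n b)"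

text \<open>
  Elements of \<open>Y_conc\<close>, as well as their compositions and convex combinations, grow at most
  linearly, so the integrand is Lebesgue integrable for them and the integral never takes
  the default value 0 of a non-integrable function.
\<close>

definition young_dist :: "(real \<Rightarrow> real) \<Rightarrow> (real \<Rightarrow> real) \<Rightarrow> real" where
  "young_dist f g = sqrt (LINT x:{0..}|lborel. (f x - g x)\<^sup>2 / (x + 1) ^ 4)"

definition dense_wrt :: "('a \<Rightarrow> 'a \<Rightarrow> real) \<Rightarrow> 'a set \<Rightarrow> 'a set \<Rightarrow> bool" where
  "dense_wrt d A Y \<longleftrightarrow> A \<subseteq> Y \<and> (\<forall>f\<in>Y. \<forall>\<epsilon>>0. \<exists>g\<in>A. d f g < \<epsilon>)"

end

theory Submission
  imports Defs
begin

text \<open>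
  Every \<open>\<Phi>\<close> in \<open>Y_at b\<close> satisfies \<open>0 \<le> \<Phi> x \<le> max b x\<close>, and this bound is inherited by compositions
  and convex combinations; hence pointwise convergence inside \<open>Y_n n b\<close> implies convergence in
  \<open>young_dist\<close> by dominated convergence. Replacing the density \<open>\<phi>\<close> beyond a point \<open>m \<ge> b\<close> by
  \<open>\<phi> m * sqrt (m / t)\<close> keeps it strictly decreasing and its primitive divergent, makes
  \<open>\<phi> t / t\<close> integrable at infinity, and does not change \<open>\<Phi>\<close> on \<open>[0, m]\<close>. Doing this to the
  outermost factor of each composition and letting \<open>m\<close> tend to infinity gives the approximation.
\<close>

section \<open>Integrals of nonnegative and of decreasing densities\<close>

lemma primitive_nonpos: "x \<le> 0 \<Longrightarrow> primitive \<phi> x = 0"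
  by (simp add: primitive_def set_lebesgue_integral_def)

lemma primitive_diff:
  assumes "0 < x" "x \<le> y" "set_integrable lborel {0<..<y} \<phi>"
  shows "primitive \<phi> y - primitive \<phi> x = (LINT t:{x..<y}|lborel. \<phi> t)"
proof -
  have "{0<..<y} = {0<..<x} \<union> {x..<y}" using assms by auto
  moreover have "set_integrable lborel {0<..<x} \<phi>"
    by (rule set_integrable_subset[OF assms(3)]) (use assms in auto)
  moreover have "set_integrable lborel {x..<y} \<phi>"
    by (rule set_integrable_subset[OF assms(3)]) (use assms in auto)
  moreover have "{0<..<x} \<inter> {x..<y} = {}" by auto
  ultimately show ?thesis
    unfolding primitive_def by (simp add: set_integral_Un)
qed

text \<open>Where \<open>\<phi>\<close> is not integrable, the integral has the default value 0, so
  the bound holds there too.\<close>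

lemma primitive_nonneg:
  assumes "\<And>t. t > 0 \<Longrightarrow> 0 \<le> \<phi> t"
  shows "0 \<le> primitive \<phi> x"
  unfolding primitive_def set_lebesgue_integral_def
  by (rule integral_nonneg_AE) (use assms in \<open>auto simp: indicator_def\<close>)

lemma primitive_mono:
  assumes nn: "\<And>t. t > 0 \<Longrightarrow> 0 \<le> \<phi> t" and int: "\<And>x. x > 0 \<Longrightarrow> set_integrable lborel {0<..<x} \<phi>"
  shows "mono (primitive \<phi>)"
proof (rule monoI)
  fix x y :: real assume xy: "x \<le> y"
  show "primitive \<phi> x \<le> primitive \<phi> y"
  proof (cases "x \<le> 0")
    case True then show ?thesis using primitive_nonneg[of \<phi> y] nn primitive_nonpos[of x] by simp
  next
    case False
    have "0 \<le> (LINT t:{x..<y}|lborel. \<phi> t)"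
      unfolding set_lebesgue_integral_def
      by (rule integral_nonneg_AE) (use False nn in \<open>auto simp: indicator_def\<close>)
    then show ?thesis using primitive_diff[of x y \<phi>] int[of y] False xy by simp
  qed
qed

lemma set_integral_Ico_const: "x \<le> y \<Longrightarrow> (LINT t:{x..<y::real}|lborel. c) = c * (y - x)"
  by (simp add: set_lebesgue_integral_def)

text \<open>Concavity in integral form: on \<open>{x..<y}\<close> a decreasing density stays below
  its value at the left endpoint. The companion lower bound uses the right endpoint.\<close>

lemma primitive_diff_le:
  assumes anti: "antimono_on {0<..} \<phi>" and "0 < x" "x \<le> y" and int: "set_integrable lborel {0<..<y} \<phi>"
  shows "primitive \<phi> y - primitive \<phi> x \<le> \<phi> x * (y - x)"
proof -
  have "(LINT t:{x..<y}|lborel. \<phi> t) \<le> (LINT t:{x..<y}|lborel. \<phi> x)"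
  proof (rule set_integral_mono)
    show "set_integrable lborel {x..<y} \<phi>"
      by (rule set_integrable_subset[OF int]) (use assms in auto)
    show "set_integrable lborel {x..<y} (\<lambda>t. \<phi> x)"
      using assms by (simp add: set_integrable_def)
  qed (use assms in \<open>auto intro!: monotone_onD[OF anti, simplified]\<close>)
  then show ?thesis using assms by (simp add: primitive_diff set_integral_Ico_const)
qed

lemma primitive_diff_ge:
  assumes anti: "antimono_on {0<..} \<phi>" and "0 < x" "x \<le> y" and int: "set_integrable lborel {0<..<y} \<phi>"
  shows "\<phi> y * (y - x) \<le> primitive \<phi> y - primitive \<phi> x"
proof -
  have "(LINT t:{x..<y}|lborel. \<phi> y) \<le> (LINT t:{x..<y}|lborel. \<phi> t)"
  proof (rule set_integral_mono)
    show "set_integrable lborel {x..<y} \<phi>"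
      by (rule set_integrable_subset[OF int]) (use assms in auto)
    show "set_integrable lborel {x..<y} (\<lambda>t. \<phi> y)"
      using assms by (simp add: set_integrable_def)
  qed (use assms in \<open>auto intro!: monotone_onD[OF anti, simplified]\<close>)
  then show ?thesis using assms by (simp add: primitive_diff set_integral_Ico_const)
qed

text \<open>This is the lower bound with left endpoint 0, proved directly on the open interval
  because \<open>\<phi>\<close> may be unbounded near 0.\<close>

lemma primitive_ge:
  assumes anti: "antimono_on {0<..} \<phi>" and "0 < y" and int: "set_integrable lborel {0<..<y} \<phi>"
  shows "\<phi> y * y \<le> primitive \<phi> y"
proof -
  have "(LINT t:{0<..<y}|lborel. \<phi> y) \<le> (LINT t:{0<..<y}|lborel. \<phi> t)"
  proof (rule set_integral_mono)
    show "set_integrable lborel {0<..<y} (\<lambda>t. \<phi> y)"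
      using assms by (simp add: set_integrable_def)
  qed (use assms in \<open>auto intro!: monotone_onD[OF anti, simplified]\<close>)
  then show ?thesis using assms by (simp add: primitive_def set_lebesgue_integral_def mult.commute)
qed

lemma strict_antimono_on_imp_antimono_on:
  fixes f :: "real \<Rightarrow> real"
  assumes "strict_antimono_on A f"
  shows "antimono_on A f"
  using assms unfolding monotone_on_def by (metis order_le_less)

section \<open>Growth of normalized concave Young functions\<close>

lemma concave_young_densityD:
  assumes "concave_young_density \<phi> \<Phi>"
  shows "t > 0 \<Longrightarrow> \<phi> t > 0" "t > 0 \<Longrightarrow> (\<phi> \<longlongrightarrow> \<phi> t) (at_right t)"
    "strict_antimono_on {0<..} \<phi>" "antimono_on {0<..} \<phi>"
    "x > 0 \<Longrightarrow> set_integrable lborel {0<..<x} \<phi>"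
    "\<Phi> = primitive \<phi>" "filterlim \<Phi> at_top at_top"
  using assms strict_antimono_on_imp_antimono_on
  unfolding concave_young_density_def by (auto simp: continuous_within)

lemma Y_at_mono: "\<Phi> \<in> Y_at b \<Longrightarrow> mono \<Phi>"
proof -
  assume "\<Phi> \<in> Y_at b"
  then obtain \<phi> where d: "concave_young_density \<phi> \<Phi>"
    by (auto simp: Y_at_def Y_conc_def)
  note D = concave_young_densityD[OF d]
  show "mono \<Phi>"
    unfolding D(6) by (rule primitive_mono) (use D(1,5) in \<open>auto intro: less_imp_le\<close>)
qed

text \<open>Up to \<open>b\<close>, monotonicity gives the bound \<open>b\<close>. Beyond
  \<open>b\<close>, the graph lies below the line of slope \<open>\<phi> b\<close> through (b, b),
  and this slope is at most 1 because \<open>\<phi> b * b \<le> \<Phi> b = b\<close>.\<close>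

lemma Y_at_bounds:
  assumes "b > 0" "\<Phi> \<in> Y_at b"
  shows "0 \<le> \<Phi> x" "\<Phi> x \<le> max b x"
proof -
  obtain \<phi> where d: "concave_young_density \<phi> \<Phi>" and b: "\<Phi> b = b"
    using assms by (auto simp: Y_at_def Y_conc_def)
  note D = concave_young_densityD[OF d]
  show "0 \<le> \<Phi> x"
    unfolding D(6) by (rule primitive_nonneg) (use D(1) in \<open>auto intro: less_imp_le\<close>)
  show "\<Phi> x \<le> max b x"
  proof (cases "x \<le> b")
    case True
    then show ?thesis using monoD[OF Y_at_mono[OF assms(2)] True] b by simp
  next
    case False
    have "\<phi> b * b \<le> b" using primitive_ge[OF D(4) assms(1) D(5)] assms b D(6) by simp
    then have "\<phi> b \<le> 1" using assms(1) by simp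
    then have "\<phi> b * (x - b) \<le> 1 * (x - b)" using False by (intro mult_right_mono) auto
    moreover have "\<Phi> x - \<Phi> b \<le> \<phi> b * (x - b)"
      unfolding D(6) by (rule primitive_diff_le[OF D(4)]) (use False assms D(5) in auto)
    ultimately show ?thesis using b by simp
  qed
qed

section \<open>Flattening the tail of a density\<close>

definition flatten :: "real \<Rightarrow> (real \<Rightarrow> real) \<Rightarrow> real \<Rightarrow> real" where
  "flatten m \<phi> t = (if t < m then \<phi> t else \<phi> m * sqrt (m / t))"

lemma primitive_flatten: "x \<le> m \<Longrightarrow> primitive (flatten m \<phi>) x = primitive \<phi> x"
  unfolding primitive_def by (rule set_lebesgue_integral_cong) (auto simp: flatten_def)

text \<open>The square root stands for any power \<open>p\<close> of \<open>m / t\<close> with 0 < p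
  \<le> 1: a positive \<open>p\<close> makes the tail strictly decreasing, and
  \<open>p \<le> 1\<close> keeps its integral divergent.\<close>

lemma concave_young_density_flatten:
  assumes d: "concave_young_density \<phi> \<Phi>" and m: "m > 0"
  shows "concave_young_density (flatten m \<phi>) (primitive (flatten m \<phi>))"
proof -
  note D = concave_young_densityD[OF d]
  let ?f = "flatten m \<phi>"
  have pos: "?f t > 0" if "t > 0" for t
    using D(1)[of t] D(1)[of m] that m by (simp add: flatten_def)
  have le: "?f t \<le> \<phi> m" if "t \<ge> m" for t
  proof -
    have "sqrt (m / t) \<le> 1" using that m by simp
    then show ?thesis using that m D(1)[of m] by (simp add: flatten_def mult_left_le)
  qed
  have anti: "strict_antimono_on {0<..} ?f"
  proof (rule monotone_onI)
    fix s t :: real assume st: "s \<in> {0<..}" "t \<in> {0<..}" "s < t"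
    consider "t < m" | "s < m" "m \<le> t" | "m \<le> s" by linarith
    then show "?f s > ?f t"
    proof cases
      case 1 then show ?thesis using monotone_onD[OF D(3) st] st by (simp add: flatten_def)
    next
      case 2
      \<comment> \<open>Across \<open>m\<close> the strict inequality comes from the original
        density; the tail only contributes \<open>?f t \<le> \<phi> m\<close>, with equality at
        \<open>t = m\<close>.\<close>
      have "\<phi> m < \<phi> s" using monotone_onD[OF D(3), of s m] st m 2 by auto
      then show ?thesis using 2 le[of t] by (simp add: flatten_def)
    next
      case 3
      have "m / t < m / s" using st m by (simp add: frac_less2)
      then show ?thesis using 3 st D(1)[of m] m by (simp add: flatten_def)
    qed
  qed
  \<comment> \<open>Only points to the right of \<open>t\<close> matter, so at \<open>t = m\<close>
    the tail formula alone decides, even if \<open>\<phi>\<close> jumps from the left there.\<close>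
  have cont: "continuous (at_right t) ?f" if t: "t > 0" for t
  proof (cases "t < m")
    case True
    have "eventually (\<lambda>s. s < m) (at_right t)" using True
      by (auto simp: eventually_at_right)
    then have "eventually (\<lambda>s. \<phi> s = ?f s) (at_right t)"
      by eventually_elim (simp add: flatten_def)
    from Lim_transform_eventually[OF D(2)[OF t] this] show ?thesis
      using True by (simp add: continuous_within flatten_def[of m \<phi> t])
  next
    case False
    have "eventually (\<lambda>s. s > t) (at_right t)" by (simp add: eventually_at_right_less)
    then have ev: "eventually (\<lambda>s. \<phi> m * sqrt (m / s) = ?f s) (at_right t)"
      by eventually_elim (use False in \<open>simp add: flatten_def\<close>)
    have "((\<lambda>s. \<phi> m * sqrt (m / s)) \<longlongrightarrow> \<phi> m * sqrt (m / t)) (at_right t)"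
      using t by (intro tendsto_intros) auto
    from Lim_transform_eventually[OF this ev] show ?thesis
      using False by (simp add: continuous_within flatten_def[of m \<phi> t])
  qed
  have anti': "antimono_on {0<..} ?f" by (rule strict_antimono_on_imp_antimono_on[OF anti])
  have int: "set_integrable lborel {0<..<x} ?f" if x: "x > 0" for x
  proof (rule set_integrable_bound)
    \<comment> \<open>The first summand dominates before \<open>m\<close>, the second from
      \<open>m\<close> on.\<close>
    show "set_integrable lborel {0<..<x} (\<lambda>t. \<phi> t + \<phi> m)"
      using D(5)[OF x] x by (intro set_integral_add) (simp_all add: set_integrable_def)
    \<comment> \<open>Measurability comes from monotonicity; the sign is flipped to have an
      increasing function.\<close>
    have "mono_on {0<..<x} (\<lambda>t. - ?f t)"
      using anti' unfolding monotone_on_def by auto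
    then have "(\<lambda>t. - ?f t) \<in> borel_measurable (restrict_space borel {0<..<x})"
      by (rule borel_measurable_mono_on_fnc)
    then have "(\<lambda>t. - (- ?f t)) \<in> borel_measurable (restrict_space borel {0<..<x})"
      by (rule borel_measurable_uminus)
    then show "set_borel_measurable lborel {0<..<x} ?f"
      by (simp add: set_borel_measurable_def borel_measurable_restrict_space_iff)
    show "AE t in lborel. t \<in> {0<..<x} \<longrightarrow> norm (?f t) \<le> norm (\<phi> t + \<phi> m)"
    proof (intro AE_I2 impI)
      fix t assume "t \<in> {0<..<x}"
      then show "norm (?f t) \<le> norm (\<phi> t + \<phi> m)"
        using pos[of t] D(1)[of t] D(1)[of m] m le[of t]
        by (cases "t < m") (simp add: flatten_def, simp)
    qed
  qed
  have "filterlim (primitive ?f) at_top at_top"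
  proof (rule filterlim_at_top_mono)
    \<comment> \<open>The minorant is \<open>?f x * (x - m)\<close>: on \<open>{m..<x}\<close> the
      decreasing density is at least its value at \<open>x\<close>. This already grows like
      \<open>sqrt x\<close>, so the tail need not be integrated exactly.\<close>
    show "filterlim (\<lambda>x. \<phi> m * sqrt m * (sqrt x - m / sqrt x)) at_top at_top"
    proof (rule filterlim_tendsto_pos_mult_at_top[OF tendsto_const])
      show "0 < \<phi> m * sqrt m" using D(1) m by simp
      have "((\<lambda>x. m / sqrt x) \<longlongrightarrow> 0) at_top"
        by (rule real_tendsto_divide_at_top[OF tendsto_const sqrt_at_top])
      then have "filterlim (\<lambda>x. - (m / sqrt x) + sqrt x) at_top at_top"
        by (intro filterlim_tendsto_add_at_top[OF tendsto_minus] sqrt_at_top)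
      then show "filterlim (\<lambda>x. sqrt x - m / sqrt x) at_top at_top" by simp
    qed
    show "eventually (\<lambda>x. \<phi> m * sqrt m * (sqrt x - m / sqrt x) \<le> primitive ?f x) at_top"
      using eventually_ge_at_top[of m]
    proof eventually_elim
      case (elim x)
      have "?f x * (x - m) \<le> primitive ?f x - primitive ?f m"
        by (rule primitive_diff_ge[OF anti']) (use m elim int in auto)
      also have "\<dots> \<le> primitive ?f x"
        using primitive_nonneg[of ?f m] pos by (simp add: less_imp_le)
      also have "?f x * (x - m) = \<phi> m * sqrt m * ((x - m) / sqrt x)"
        using elim m by (simp add: flatten_def real_sqrt_divide)
      also have "(x - m) / sqrt x = sqrt x - m / sqrt x"
        using elim m by (simp add: diff_divide_distrib real_div_sqrt)
      finally show ?case .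
    qed
  qed
  with pos cont anti int show ?thesis unfolding concave_young_density_def by blast
qed

text \<open>Dividing the tail by \<open>t\<close> leaves decay of order
  \<open>1 / (t * sqrt t)\<close>, which is integrable at infinity.\<close>

lemma nn_integral_flatten_over_t:
  assumes d: "concave_young_density \<phi> \<Phi>" and m: "m > 0"
  shows "(\<integral>\<^sup>+t\<in>{1..}. ennreal (flatten m \<phi> t / t) \<partial>lborel) < \<infinity>"
proof -
  note D = concave_young_densityD[OF d]
  \<comment> \<open>One constant serves both \<open>m < 1\<close> and \<open>m \<ge> 1\<close>:
    \<open>\<phi> (min 1 m)\<close> bounds \<open>\<phi> t\<close> for \<open>t \<ge> 1\<close> as
    well as \<open>\<phi> m\<close>, and \<open>sqrt (max 1 m / t)\<close> is at least 1 for
    \<open>t < m\<close> and at least \<open>sqrt (m / t)\<close> always.\<close>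
  let ?C = "\<phi> (min 1 m) * sqrt (max 1 m)"
  have bound: "flatten m \<phi> t / t \<le> ?C * (1 / (t * sqrt t))" if "t \<ge> 1" for t
  proof -
    have "flatten m \<phi> t \<le> \<phi> (min 1 m) * sqrt (max 1 m / t)"
    proof (cases "t < m")
      case True
      have "\<phi> t \<le> \<phi> (min 1 m)"
        using that m by (intro monotone_onD[OF D(4), simplified]) auto
      moreover have "1 \<le> sqrt (max 1 m / t)" using True that by simp
      moreover have "0 < \<phi> (min 1 m)" using D(1) m by simp
      ultimately have "\<phi> t * 1 \<le> \<phi> (min 1 m) * sqrt (max 1 m / t)"
        by (intro mult_mono) auto
      then show ?thesis using True by (simp add: flatten_def)
    next
      case False
      have "\<phi> m \<le> \<phi> (min 1 m)"
        using that m by (intro monotone_onD[OF D(4), simplified]) auto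
      moreover have "sqrt (m / t) \<le> sqrt (max 1 m / t)"
        using that by (intro real_sqrt_le_mono divide_right_mono) auto
      moreover have "0 < \<phi> (min 1 m)" using D(1) m by simp
      ultimately show ?thesis using False m that by (auto simp: flatten_def intro!: mult_mono)
    qed
    then have "flatten m \<phi> t / t \<le> \<phi> (min 1 m) * sqrt (max 1 m / t) / t"
      using that by (intro divide_right_mono) auto
    then show ?thesis by (simp add: real_sqrt_divide mult.commute)
  qed
  have "(\<integral>\<^sup>+t\<in>{1..}. ennreal (flatten m \<phi> t / t) \<partial>lborel)
      \<le> (\<integral>\<^sup>+t\<in>{1..}. ennreal (?C * (1 / (t * sqrt t))) \<partial>lborel)"
    by (intro nn_integral_mono) (use bound in \<open>auto simp: indicator_def intro!: ennreal_leI\<close>)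
  also have "\<dots> = ennreal (0 - (- 2 * ?C / sqrt 1))"
  proof (rule nn_integral_FTC_atLeast[where F = "\<lambda>t. - 2 * ?C / sqrt t"])
    show "(\<lambda>t. ?C * (1 / (t * sqrt t))) \<in> borel_measurable borel" by measurable
    fix t :: real assume t: "1 \<le> t"
    show "DERIV (\<lambda>t. - 2 * ?C / sqrt t) t :> ?C * (1 / (t * sqrt t))"
      using t by (auto intro!: derivative_eq_intros simp: field_simps)
    show "0 \<le> ?C * (1 / (t * sqrt t))" using t D(1)[of "min 1 m"] m by simp
  next
    show "((\<lambda>t. - 2 * ?C / sqrt t) \<longlongrightarrow> 0) at_top"
      by (rule real_tendsto_divide_at_top[OF tendsto_const sqrt_at_top])
  qed
  finally show ?thesis by (simp add: le_less_trans[OF _ ennreal_less_top])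
qed

text \<open>Taking \<open>m \<ge> b\<close> puts the point \<open>b\<close> in the unchanged range,
  so the normalization at \<open>b\<close> survives the flattening.\<close>

lemma A_at_agreeing:
  assumes "\<Phi> \<in> Y_at b" "b > 0" "m \<ge> b"
  obtains \<Psi> where "\<Psi> \<in> A_at b" "\<Psi> \<in> Y_at b" "\<And>x. x \<le> m \<Longrightarrow> \<Psi> x = \<Phi> x"
proof -
  obtain \<phi> where d: "concave_young_density \<phi> \<Phi>" and b: "\<Phi> b = b"
    using assms by (auto simp: Y_at_def Y_conc_def)
  have m: "m > 0" using assms by simp
  let ?\<Psi> = "primitive (flatten m \<phi>)"
  have eq: "?\<Psi> x = \<Phi> x" if "x \<le> m" for x
    using primitive_flatten[OF that] concave_young_densityD(6)[OF d] by simp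
  show thesis
    by (rule that[of ?\<Psi>])
      (use concave_young_density_flatten[OF d m] nn_integral_flatten_over_t[OF d m] eq b assms
        in \<open>auto simp: A_at_def class_A_def Y_at_def Y_conc_def\<close>)
qed

section \<open>Compositions and their approximation\<close>

lemma compose_list_simps [simp]:
  "compose_list [] = id" "compose_list (f # fs) = f \<circ> compose_list fs"
  by (simp_all add: compose_list_def)

text \<open>The bound reproduces itself under composition, since
  \<open>max b (max b x) = max b x\<close>.\<close>

lemma compose_list_bounds:
  assumes "b > 0" "set \<Delta>s \<subseteq> Y_at b" "x \<ge> 0"
  shows "0 \<le> compose_list \<Delta>s x \<and> compose_list \<Delta>s x \<le> max b x"
  using assms(2)
proof (induction \<Delta>s)
  case (Cons \<Delta> \<Delta>s)
  then show ?case
    using Y_at_bounds[of b \<Delta> "compose_list \<Delta>s x"] assms(1) by force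
qed (use assms in auto)

lemma Y_CO_bounds:
  assumes "b > 0" "f \<in> Y_CO n b" "x \<ge> 0"
  shows "0 \<le> f x" "f x \<le> max b x"
  using assms compose_list_bounds by (auto simp: Y_CO_def)

text \<open>Compositions of monotone functions are monotone, hence Borel measurable.\<close>

lemma Y_CO_borel:
  assumes "f \<in> Y_CO n b"
  shows "f \<in> borel_measurable borel"
proof -
  have "mono (compose_list \<Delta>s)" if "set \<Delta>s \<subseteq> Y_at b" for \<Delta>s
    using that
  proof (induction \<Delta>s)
    case (Cons \<Delta> \<Delta>s)
    then show ?case using Y_at_mono[of \<Delta> b] by (auto simp: mono_def)
  qed (simp add: mono_def)
  then show ?thesis using assms by (auto simp: Y_CO_def intro: borel_measurable_mono)
qed

lemma A_CO_subset: "A_CO n b \<subseteq> Y_CO n b"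
  by (auto simp: A_CO_def Y_CO_def)

lemma convex_combinations_mono:
  assumes "S \<subseteq> T"
  shows "convex_combinations S \<subseteq> convex_combinations T"
  using assms unfolding convex_combinations_def by blast

lemma A_CO_sequence:
  assumes "f \<in> Y_CO n b" "n \<ge> 1" "b > 0"
  obtains F where "\<And>m::nat. F m \<in> A_CO n b" "\<And>x. (\<lambda>m. F m x) \<longlonglongrightarrow> f x"
proof -
  obtain \<Delta> \<Delta>s where f: "f = \<Delta> \<circ> compose_list \<Delta>s" and Y: "\<Delta> \<in> Y_at b" "set \<Delta>s \<subseteq> Y_at b"
    and len: "Suc (length \<Delta>s) = n"
    using assms(1,2) by (auto simp: Y_CO_def neq_Nil_conv Suc_le_length_iff)
  \<comment> \<open>The cutoff \<open>max b m\<close> is at least \<open>b\<close> for every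
    \<open>m\<close>, as \<open>A_at_agreeing\<close> demands.\<close>
  have "\<exists>\<Psi>. \<Psi> \<in> A_at b \<and> \<Psi> \<in> Y_at b \<and> (\<forall>x\<le>max b m. \<Psi> x = \<Delta> x)" for m
    using A_at_agreeing[OF Y(1) assms(3), of "max b m"] by (metis max.cobounded1)
  then obtain \<Psi> where \<Psi>: "\<And>m. \<Psi> m \<in> A_at b" "\<And>m. \<Psi> m \<in> Y_at b"
      "\<And>m x. x \<le> max b m \<Longrightarrow> \<Psi> m x = \<Delta> x"
    by metis
  show thesis
  proof
    show "compose_list (\<Psi> (real m) # \<Delta>s) \<in> A_CO n b" for m
      \<comment> \<open>The factor in \<open>A_at b\<close> is the head of the list, hence index
        0.\<close>
      unfolding A_CO_def using \<Psi> Y len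
      by (intro CollectI exI[of _ "\<Psi> (real m) # \<Delta>s"]) (auto intro!: exI[of _ 0])
    show "(\<lambda>m. compose_list (\<Psi> (real m) # \<Delta>s) x) \<longlonglongrightarrow> f x" for x
    proof (rule tendsto_eventually)
      show "\<forall>\<^sub>F m in sequentially. compose_list (\<Psi> (real m) # \<Delta>s) x = f x"
        using eventually_ge_at_top[of "nat \<lceil>compose_list \<Delta>s x\<rceil>"]
      proof eventually_elim
        case (elim m)
        then have "compose_list \<Delta>s x \<le> max b (real m)" by linarith
        then show ?case using \<Psi>(3) by (simp add: f)
      qed
    qed
  qed
qed

section \<open>Bounds and measurability of convex combinations\<close>

lemma convex_combination_bounds:
  fixes t :: "nat \<Rightarrow> real"
  assumes "\<And>i. i \<in> {1..k} \<Longrightarrow> 0 \<le> t i" "(\<Sum>i=1..k. t i) = 1"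
    and "\<And>i. i \<in> {1..k} \<Longrightarrow> 0 \<le> y i" "\<And>i. i \<in> {1..k} \<Longrightarrow> y i \<le> c"
  shows "0 \<le> (\<Sum>i=1..k. t i * y i)" "(\<Sum>i=1..k. t i * y i) \<le> c"
proof -
  show "0 \<le> (\<Sum>i=1..k. t i * y i)" using assms by (intro sum_nonneg) auto
  have "(\<Sum>i=1..k. t i * y i) \<le> (\<Sum>i=1..k. t i * c)"
    using assms by (intro sum_mono mult_left_mono) auto
  then show "(\<Sum>i=1..k. t i * y i) \<le> c" using assms(2) by (simp flip: sum_distrib_right)
qed

lemma Y_n_bounds:
  assumes "b > 0" "f \<in> Y_n n b" "x \<ge> 0"
  shows "0 \<le> f x" "f x \<le> max b x"
proof -
  obtain k :: nat and t \<Delta> where k: "\<forall>i\<in>{1..k}. t i \<in> {0..1}" "(\<Sum>i=1..k. t i) = 1"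
    and \<Delta>: "\<forall>i\<in>{1..k}. \<Delta> i \<in> Y_CO n b" and f: "f = (\<lambda>x. \<Sum>i=1..k. t i * \<Delta> i x)"
    using assms(2) unfolding Y_n_def convex_combinations_def by blast
  have *: "0 \<le> t i" "0 \<le> \<Delta> i x" "\<Delta> i x \<le> max b x" if "i \<in> {1..k}" for i
    using k(1) \<Delta> that Y_CO_bounds[OF assms(1) _ assms(3), of "\<Delta> i" n] by simp_all
  show "0 \<le> f x" "f x \<le> max b x"
    unfolding f using convex_combination_bounds[OF *(1) k(2) *(2,3)] by simp_all
qed

lemma Y_n_borel:
  assumes "f \<in> Y_n n b"
  shows "f \<in> borel_measurable borel"
proof -
  obtain k :: nat and t \<Delta> where "\<forall>i\<in>{1..k}. \<Delta> i \<in> Y_CO n b"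
    and f: "f = (\<lambda>x. \<Sum>i=1..k. t i * \<Delta> i x)"
    using assms unfolding Y_n_def convex_combinations_def by blast
  then show ?thesis
    unfolding f by (intro borel_measurable_sum borel_measurable_times borel_measurable_const)
      (auto intro: Y_CO_borel)
qed

section \<open>From pointwise convergence to convergence in \<open>young_dist\<close>\<close>

lemma set_integrable_inverse_square: "set_integrable lborel {0..} (\<lambda>x::real. c / (x + 1)\<^sup>2)"
proof -
  have "set_integrable lborel {0..} (\<lambda>x::real. 1 / (x + 1)\<^sup>2)"
    unfolding set_integrable_def
  proof (rule integrableI_bounded)
    have "(\<integral>\<^sup>+x\<in>{0..}. ennreal (1 / (x + 1)\<^sup>2) \<partial>lborel) = ennreal (0 - (- 1 / (0 + 1::real)))"
    proof (rule nn_integral_FTC_atLeast[where F = "\<lambda>x. - 1 / (x + 1)"])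
      fix x :: real assume "0 \<le> x"
      then show "DERIV (\<lambda>x. - 1 / (x + 1)) x :> 1 / (x + 1)\<^sup>2"
        by (auto intro!: derivative_eq_intros simp: power2_eq_square)
    next
      show "((\<lambda>x::real. - 1 / (x + 1)) \<longlongrightarrow> 0) at_top"
        by (rule real_tendsto_divide_at_top[OF tendsto_const])
          (use filterlim_tendsto_add_at_top[OF tendsto_const[of "1::real"] filterlim_ident]
            in \<open>simp add: add.commute\<close>)
    qed auto
    moreover have "(\<integral>\<^sup>+x. ennreal (norm (indicator {0..} x *\<^sub>R (1 / (x + 1 :: real)\<^sup>2))) \<partial>lborel)
      = (\<integral>\<^sup>+x\<in>{0..}. ennreal (1 / (x + 1 :: real)\<^sup>2) \<partial>lborel)"
      by (rule nn_integral_cong) (simp add: indicator_def)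
    ultimately show "(\<integral>\<^sup>+x. ennreal (norm (indicator {0..} x *\<^sub>R (1 / (x + 1 :: real)\<^sup>2))) \<partial>lborel) < \<infinity>"
      by simp
  qed measurable
  from set_integrable_mult_right[of c, OF this] show ?thesis by simp
qed

lemma young_dist_tendsto_0:
  assumes "b > 0" and f: "f \<in> Y_n n b" and g: "\<And>m::nat. g m \<in> Y_n n b"
    and lim: "\<And>x. (\<lambda>m. g m x) \<longlonglongrightarrow> f x"
  shows "(\<lambda>m. young_dist f (g m)) \<longlonglongrightarrow> 0"
proof -
  have [measurable]: "f \<in> borel_measurable borel" "g m \<in> borel_measurable borel" for m
    using f g Y_n_borel by blast+
  have "(\<lambda>m. LINT x:{0..}|lborel. (f x - g m x)\<^sup>2 / (x + 1) ^ 4)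
      \<longlonglongrightarrow> (LINT x:{0..}|(lborel :: real measure). (0::real))"
    unfolding set_lebesgue_integral_def
  \<comment> \<open>The majorant comes from \<open>(max b x)\<^sup>2 \<le> b\<^sup>2 + x\<^sup>2
    \<le> (b\<^sup>2 + 1) * (x + 1)\<^sup>2\<close> for \<open>x \<ge> 0\<close>, divided by
    \<open>(x + 1) ^ 4\<close>.\<close>
  proof (rule integral_dominated_convergence[where w = "\<lambda>x. indicator {0..} x *\<^sub>R ((b\<^sup>2 + 1) / (x + 1)\<^sup>2)"])
    show "integrable lborel (\<lambda>x::real. indicator {0..} x *\<^sub>R ((b\<^sup>2 + 1) / (x + 1)\<^sup>2))"
      using set_integrable_inverse_square unfolding set_integrable_def .
    show "AE x in lborel. (\<lambda>m. indicator {0..} x *\<^sub>R ((f x - g m x)\<^sup>2 / (x + 1) ^ 4))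
        \<longlonglongrightarrow> indicator {0..} x *\<^sub>R (0::real)"
    proof (rule AE_I2)
      fix x
      \<comment> \<open>Here \<open>x\<close> is an arbitrary real, possibly -1; writing the
        quotient as a product with a constant \<open>inverse\<close> avoids a nonzero denominator
        condition.\<close>
      have "(\<lambda>m. indicator {0..} x *\<^sub>R ((f x - g m x)\<^sup>2 * inverse ((x + 1) ^ 4)))
        \<longlonglongrightarrow> indicator {0..} x *\<^sub>R ((f x - f x)\<^sup>2 * inverse ((x + 1) ^ 4))"
        by (intro tendsto_intros lim)
      then show "(\<lambda>m. indicator {0..} x *\<^sub>R ((f x - g m x)\<^sup>2 / (x + 1) ^ 4))
        \<longlonglongrightarrow> indicator {0..} x *\<^sub>R (0::real)" by (simp add: divide_inverse)
    qed
    show "AE x in lborel. norm (indicator {0..} x *\<^sub>R ((f x - g m x)\<^sup>2 / (x + 1) ^ 4))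
        \<le> indicator {0..} x *\<^sub>R ((b\<^sup>2 + 1) / (x + 1)\<^sup>2)" for m
    proof (rule AE_I2)
      fix x :: real
      have "(f x - g m x)\<^sup>2 / (x + 1) ^ 4 \<le> (b\<^sup>2 + 1) / (x + 1)\<^sup>2" if x: "x \<ge> 0"
      proof -
        \<comment> \<open>Both values lie in the interval from 0 to \<open>max b x\<close>, so their
          distance is at most its length.\<close>
        have "\<bar>f x - g m x\<bar> \<le> max b x"
          using Y_n_bounds[OF assms(1) f x] Y_n_bounds[OF assms(1) g x, of m] by linarith
        then have "(f x - g m x)\<^sup>2 \<le> (max b x)\<^sup>2"
          by (metis abs_ge_zero power2_abs power_mono)
        also have "\<dots> \<le> b\<^sup>2 + x\<^sup>2" by (simp add: max_def)
        also have "\<dots> \<le> b\<^sup>2 * (x + 1)\<^sup>2 + 1 * (x + 1)\<^sup>2"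
          using x by (intro add_mono) (simp_all add: mult_le_cancel_left1)
        finally have "(f x - g m x)\<^sup>2 / (x + 1) ^ 4 \<le> ((b\<^sup>2 + 1) * (x + 1)\<^sup>2) / (x + 1) ^ 4"
          using x by (intro divide_right_mono) (auto simp: algebra_simps)
        also have "\<dots> = (b\<^sup>2 + 1) / (x + 1)\<^sup>2"
          using x by (simp add: power4_eq_xxxx power2_eq_square)
        finally show ?thesis .
      qed
      then show "norm (indicator {0..} x *\<^sub>R ((f x - g m x)\<^sup>2 / (x + 1) ^ 4))
        \<le> indicator {0..} x *\<^sub>R ((b\<^sup>2 + 1) / (x + 1)\<^sup>2)"
        by (auto simp: indicator_def)
    qed
  qed measurable
  then have "(\<lambda>m. LINT x:{0..}|lborel. (f x - g m x)\<^sup>2 / (x + 1) ^ 4) \<longlonglongrightarrow> 0"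
    by (simp add: set_lebesgue_integral_def)
  from tendsto_real_sqrt[OF this] show ?thesis by (simp add: young_dist_def)
qed

section \<open>Density of the convex combinations\<close>

theorem theorem8:
  fixes n :: nat and b :: real
  assumes "n \<ge> 2" and "b > 0"
  shows "dense_wrt young_dist (A_n n b) (Y_n n b)"
  unfolding dense_wrt_def
proof (intro conjI ballI allI impI)
  show sub: "A_n n b \<subseteq> Y_n n b"
    unfolding A_n_def Y_n_def by (rule convex_combinations_mono[OF A_CO_subset])
  fix f and \<epsilon> :: real
  assume f: "f \<in> Y_n n b" and \<epsilon>: "\<epsilon> > 0"
  obtain k :: nat and t \<Delta> where k: "k \<ge> 1" "\<forall>i\<in>{1..k}. t i \<in> {0..1}" "(\<Sum>i=1..k. t i) = 1"
    and \<Delta>: "\<forall>i\<in>{1..k}. \<Delta> i \<in> Y_CO n b" and f_eq: "f = (\<lambda>x. \<Sum>i=1..k. t i * \<Delta> i x)"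
    using f unfolding Y_n_def convex_combinations_def by blast
  have "\<forall>i\<in>{1..k}. \<exists>F. (\<forall>m::nat. F m \<in> A_CO n b) \<and> (\<forall>x. (\<lambda>m. F m x) \<longlonglongrightarrow> \<Delta> i x)"
  proof
    fix i assume "i \<in> {1..k}"
    then have "\<Delta> i \<in> Y_CO n b" using \<Delta> by blast
    then obtain F where "\<And>m::nat. F m \<in> A_CO n b" "\<And>x. (\<lambda>m. F m x) \<longlonglongrightarrow> \<Delta> i x"
      using A_CO_sequence[of "\<Delta> i" n b] assms by auto
    then show "\<exists>F. (\<forall>m::nat. F m \<in> A_CO n b) \<and> (\<forall>x. (\<lambda>m. F m x) \<longlonglongrightarrow> \<Delta> i x)" by blast
  qed
  then obtain F where F: "\<And>i m. i \<in> {1..k} \<Longrightarrow> F i (m::nat) \<in> A_CO n b"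
      "\<And>i x. i \<in> {1..k} \<Longrightarrow> (\<lambda>m. F i m x) \<longlonglongrightarrow> \<Delta> i x"
    by metis
  \<comment> \<open>The number of terms and the weights stay fixed; each composition is replaced by
    its own approximating sequence, and the finite sum passes to the limit.\<close>
  define g where "g m = (\<lambda>x. \<Sum>i=1..k. t i * F i m x)" for m
  have g: "g m \<in> A_n n b" for m
    unfolding A_n_def convex_combinations_def g_def using k F(1)
    by (intro CollectI exI[of _ k] exI[of _ t] exI[of _ "\<lambda>i. F i m"]) simp
  have "(\<lambda>m. young_dist f (g m)) \<longlonglongrightarrow> 0"
  proof (rule young_dist_tendsto_0[OF assms(2) f])
    show "g m \<in> Y_n n b" for m using g sub by blast
    show "(\<lambda>m. g m x) \<longlonglongrightarrow> f x" for x
      unfolding g_def f_eq by (intro tendsto_sum tendsto_mult tendsto_const F(2))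
  qed
  from order_tendstoD(2)[OF this \<epsilon>] obtain m where "young_dist f (g m) < \<epsilon>"
    by (auto simp: eventually_sequentially)
  then show "\<exists>g\<in>A_n n b. young_dist f g < \<epsilon>" using g by blast
qed

end
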